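(* Consider the linear-Gaussian inverse problem on $\mathcal{H}$ and its $n$-dimensional discretizations described in the context. Assume: (i) there are a constant $r_1\in\mathbb{R}$ and a function $\psi_1:\mathbb{N}\to\mathbb{R}$ with $\lim_{n\to\infty}\psi_1(n)=0$ such that $\|\mathcal{C}_0-P^*C_0P\|_{op}\le r_1\psi_1(n)$; (ii) there are a constant $r_2\in\mathbb{R}$ and a function $\psi_2:\mathbb{N}\to\mathbb{R}$ with $\lim_{n\to\infty}\psi_2(n)=0$ such that $\|\mathcal{F}-FP\|_{op}\le r_2\psi_2(n)$; (iii) there are a Hilbert space $\mathcal{H}'$ continuously embedded in $\mathcal{H}$, a constant $r_3\in\mathbb{R}$ and a function $\psi_3:\mathbb{N}\to\mathbb{R}$ with $\lim_{n\to\infty}\psi_3(n)=0$ such that $\|(I-P^*P)u\|_{\mathcal{H}}\le r_3\psi_3(n)\|u\|_{\mathcal{H}'}$ for every $u\in\mathcal{H}'$. Then the error $\varepsilon_m=\|m_{\text{post}}-P^*\vec m_{\text{post}}\|_{\mathcal{H}}$ satisfies $$\varepsilon_m\le r_1'\psi_1(n)+r_2'\psi_2(n)+r_3'\psi_3(n),$$ where $$r_1'=2c_1r_1\|y-\mathcal{F}m_0\|_2,\qquad r_2'=2c_2r_2\|y-\mathcal{F}m_0\|_2+r_2\|m_0\|_{\mathcal{H}}\|\mathscr{K}(\mathcal{C}_0,\mathcal{F})\|_{op},\qquad r_3'=r_3\|m_0\|_{\mathcal{H}'},$$ $\mathscr{K}(\mathcal{C},\mathcal{F})=\mathcal{C}\mathcal{F}^*(\mathcal{F}\mathcal{C}\mathcal{F}^*+\Gamma)^{-1}$,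 and, with $(\mathcal{C}_1,\mathcal{F}_1)=(\mathcal{C}_0,\mathcal{F})$ and $(\mathcal{C}_2,\mathcal{F}_2)=(P^*C_0P,FP)$, $$c_1=\|\Gamma^{-1}\|_{op}\|\mathcal{F}_2\|_{op}+\|\Gamma^{-1}\|_{op}^2\|\mathcal{C}_1\|_{op}\|\mathcal{F}_1\|_{op}\|\mathcal{F}_2\|_{op}^2,$$ $$c_2=\|\Gamma^{-1}\|_{op}\|\mathcal{C}_1\|_{op}+\|\Gamma^{-1}\|_{op}^2\|\mathcal{C}_1\|_{op}^2\|\mathcal{F}_1\|_{op}^2+\|\Gamma^{-1}\|_{op}^2\|\mathcal{C}_1\|_{op}^2\|\mathcal{F}_1\|_{op}\|\mathcal{F}_2\|_{op}.$$
   Context: Continuum problem: $\mathcal{H}$ is an infinite-dimensional separable real Hilbert space, $\mathcal{F}:\mathcal{H}\to\mathbb{R}^{d_y}$ is linear and bounded, $\Gamma$ is a symmetric positive definite $d_y\times d_y$ matrix, $y\in\mathbb{R}^{d_y}$ is given data, and the prior is the Gaussian measure $\mathcal{N}(m_0,\mathcal{C}_0)$ on $\mathcal{H}$, where $\mathcal{C}_0$ is a trace-class covariance operator and $m_0\in\mathrm{Im}(\mathcal{C}_0^{1/2})$. The posterior for the model $y=\mathcal{F}u+\eta$, $\eta\sim\mathcal{N}(0,\Gamma)$, is Gaussian with mean $$m_{\text{post}}=m_0+\mathcal{C}_0\mathcal{F}^*(\mathcal{F}\mathcal{C}_0\mathcal{F}^*+\Gamma)^{-1}(y-\mathcal{F}m_0).$$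 Discretization (for each $n\in\mathbb{N}$; dependence on $n$ is suppressed): $\mathcal{V}\subset\mathcal{H}$ is an $n$-dimensional subspace with basis $\phi_1,\dots,\phi_n$; $M_{ij}=\langle\phi_i,\phi_j\rangle_{\mathcal{H}}$; $\mathbb{R}^n_M$ is $\mathbb{R}^n$ with inner product $\langle\vec u,\vec v\rangle_M=\vec u^TM\vec v$. The map $P:\mathcal{H}\to\mathbb{R}^n_M$ sends $u$ to the coefficient vector of the $\mathcal{H}$-orthogonal projection of $u$ onto $\mathcal{V}$, and $P^*:\mathbb{R}^n_M\to\mathcal{V}\subset\mathcal{H}$ is $P^*\vec u=\sum_iu_i\phi_i$ (the adjoint of $P$). $F:\mathbb{R}^n_M\to\mathbb{R}^{d_y}$ is a linear discretized forward model (a $d_y\times n$ matrix) with adjoint $F^\natural=M^{-1}F^T$; $C_0:\mathbb{R}^n_M\to\mathbb{R}^n_M$ is an invertible covariance operator (self-adjoint and positive definite with respect to $\langle\cdot,\cdot\rangle_M$); $\vec m_0=Pm_0$. The discretized posterior has mean $$\vec m_{\text{post}}=\vec m_0+C_0F^\natural(FC_0F^\natural+\Gamma)^{-1}(y-F\vec m_0).$$ $\|\cdot\|_{op}$ is the operator norm between the relevant normed spaces; $\mathbb{R}^{d_y}$ carries the Euclidean norm $\|\cdot\|_2$.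
   Formalization: As stated the bound can fail (e.g. when y = 𝓕m_0); it is proved for each n ≥ 1 with ‖y − FPm_0‖ ≤ 2‖y − 𝓕m_0‖, and for all sufficiently large n if y ≠ 𝓕m_0. It is also assumed that m_0 lies in H', so that ‖m_0‖_{H'} is defined. *)

theory Defs
  imports "HOL-Analysis.Analysis"
begin

section \<open>The continuum problem\<close>

definition infinite_dimensional :: "'h::real_vector itself \<Rightarrow> bool" where
  "infinite_dimensional _ \<longleftrightarrow> (\<forall>B::'h set. finite B \<longrightarrow> span B \<noteq> UNIV)"

definition orthonormal_basis :: "'h::real_inner set \<Rightarrow> bool" where
  "orthonormal_basis E \<longleftrightarrow>
     pairwise orthogonal E \<and> (\<forall>e\<in>E. norm e = 1) \<and> closure (span E) = UNIV"

definition positive_op :: "('h::real_inner \<Rightarrow> 'h) \<Rightarrow> bool" where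
  "positive_op T \<longleftrightarrow>
     bounded_linear T \<and> (\<forall>u v. T u \<bullet> v = u \<bullet> T v) \<and> (\<forall>u. 0 \<le> T u \<bullet> u)"

text \<open>For a positive operator, trace class means that the sum of the diagonal entries is finite in
  one, equivalently in every, orthonormal basis.\<close>

definition trace_class_covariance :: "('h::real_inner \<Rightarrow> 'h) \<Rightarrow> bool" where
  "trace_class_covariance T \<longleftrightarrow>
     positive_op T \<and> (\<exists>E. orthonormal_basis E \<and> (\<lambda>e. T e \<bullet> e) summable_on E)"

text \<open>A positive operator on a Hilbert space has exactly one positive square root.\<close>

definition sqrt_op :: "('h::real_inner \<Rightarrow> 'h) \<Rightarrow> ('h \<Rightarrow> 'h)" where
  "sqrt_op T = (THE S. positive_op S \<and> S \<circ> S = T)"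

definition spd_matrix :: "real^'d^'d \<Rightarrow> bool" where
  "spd_matrix \<Gamma> \<longleftrightarrow> transpose \<Gamma> = \<Gamma> \<and> (\<forall>v. v \<noteq> 0 \<longrightarrow> 0 < v \<bullet> (\<Gamma> *v v))"

text \<open>Both \<open>gain\<close> and \<open>disc_gain\<close> below use the inverse \<open>inv\<close> of a linear map from the data space to
  itself; that map is a bijection because \<open>\<Gamma>\<close> is positive definite and the other summand is
  positive semidefinite.\<close>

definition gain ::
    "real^'d^'d \<Rightarrow> ('h::real_inner \<Rightarrow> 'h) \<Rightarrow> ('h \<Rightarrow> real^'d) \<Rightarrow> real^'d \<Rightarrow> 'h" where
  "gain \<Gamma> C F =
     (\<lambda>w. C (adjoint F (inv (\<lambda>v. F (C (adjoint F v)) + \<Gamma> *v v) w)))"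

definition post_mean ::
    "real^'d^'d \<Rightarrow> ('h::real_inner \<Rightarrow> 'h) \<Rightarrow> ('h \<Rightarrow> real^'d) \<Rightarrow> real^'d \<Rightarrow> 'h \<Rightarrow> 'h" where
  "post_mean \<Gamma> C F y m0 = m0 + gain \<Gamma> C F (y - F m0)"

section \<open>The discretization\<close>

text \<open>The dimension \<open>n\<close> varies, so a vector of \<open>\<real>\<^sup>n\<close> is a function \<open>nat \<Rightarrow> real\<close>, an
  \<open>n \<times> n\<close> matrix a function \<open>nat \<Rightarrow> nat \<Rightarrow> real\<close> and a \<open>d\<^sub>y \<times> n\<close> matrix a function
  \<open>'d \<Rightarrow> nat \<Rightarrow> real\<close>. Only the entries with indices below \<open>n\<close> are meaningful.\<close>

definition nmat_app :: "nat \<Rightarrow> (nat \<Rightarrow> nat \<Rightarrow> real) \<Rightarrow> (nat \<Rightarrow> real) \<Rightarrow> (nat \<Rightarrow> real)" where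
  "nmat_app n A u = (\<lambda>i. \<Sum>j<n. A i j * u j)"

definition inverse_nmat ::
    "nat \<Rightarrow> (nat \<Rightarrow> nat \<Rightarrow> real) \<Rightarrow> (nat \<Rightarrow> nat \<Rightarrow> real) \<Rightarrow> bool" where
  "inverse_nmat n A B \<longleftrightarrow>
     (\<forall>i<n. \<forall>j<n. (\<Sum>k<n. A i k * B k j) = of_bool (i = j) \<and>
                   (\<Sum>k<n. B i k * A k j) = of_bool (i = j))"

definition nmat_inv :: "nat \<Rightarrow> (nat \<Rightarrow> nat \<Rightarrow> real) \<Rightarrow> (nat \<Rightarrow> nat \<Rightarrow> real)" where
  "nmat_inv n A = (SOME B. inverse_nmat n A B)"

definition basis_family :: "nat \<Rightarrow> (nat \<Rightarrow> 'h::real_vector) \<Rightarrow> bool" where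
  "basis_family n \<phi> \<longleftrightarrow> inj_on \<phi> {..<n} \<and> independent (\<phi> ` {..<n})"

definition gram :: "(nat \<Rightarrow> 'h::real_inner) \<Rightarrow> nat \<Rightarrow> nat \<Rightarrow> real" where
  "gram \<phi> i j = \<phi> i \<bullet> \<phi> j"

definition inner_M ::
    "nat \<Rightarrow> (nat \<Rightarrow> 'h::real_inner) \<Rightarrow> (nat \<Rightarrow> real) \<Rightarrow> (nat \<Rightarrow> real) \<Rightarrow> real" where
  "inner_M n \<phi> u v = (\<Sum>i<n. u i * nmat_app n (gram \<phi>) v i)"

text \<open>\<open>synth\<close> is the map \<open>P\<^sup>*\<close> and \<open>coords\<close> is the map \<open>P\<close>.\<close>

definition synth :: "nat \<Rightarrow> (nat \<Rightarrow> 'h::real_vector) \<Rightarrow> (nat \<Rightarrow> real) \<Rightarrow> 'h" where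
  "synth n \<phi> u = (\<Sum>i<n. u i *\<^sub>R \<phi> i)"

definition orth_proj :: "'h::real_inner set \<Rightarrow> 'h \<Rightarrow> 'h" where
  "orth_proj V u = (THE p. p \<in> V \<and> (\<forall>v\<in>V. (u - p) \<bullet> v = 0))"

definition coords :: "nat \<Rightarrow> (nat \<Rightarrow> 'h::real_inner) \<Rightarrow> 'h \<Rightarrow> (nat \<Rightarrow> real)" where
  "coords n \<phi> u =
     (THE c. (\<forall>i\<ge>n. c i = 0) \<and> synth n \<phi> c = orth_proj (span (\<phi> ` {..<n})) u)"

definition disc_covariance ::
    "nat \<Rightarrow> (nat \<Rightarrow> 'h::real_inner) \<Rightarrow> (nat \<Rightarrow> nat \<Rightarrow> real) \<Rightarrow> bool" where
  "disc_covariance n \<phi> C \<longleftrightarrow>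
     (\<exists>B. inverse_nmat n C B) \<and>
     (\<forall>u v. inner_M n \<phi> (nmat_app n C u) v = inner_M n \<phi> u (nmat_app n C v)) \<and>
     (\<forall>u. (\<exists>i<n. u i \<noteq> 0) \<longrightarrow> 0 < inner_M n \<phi> (nmat_app n C u) u)"

definition fwd_app :: "nat \<Rightarrow> ('d \<Rightarrow> nat \<Rightarrow> real) \<Rightarrow> (nat \<Rightarrow> real) \<Rightarrow> real^'d" where
  "fwd_app n F u = (\<chi> k. \<Sum>j<n. F k j * u j)"

definition fwd_adj ::
    "nat \<Rightarrow> (nat \<Rightarrow> 'h::real_inner) \<Rightarrow> ('d \<Rightarrow> nat \<Rightarrow> real) \<Rightarrow> real^'d \<Rightarrow> (nat \<Rightarrow> real)" where
  "fwd_adj n \<phi> F w = nmat_app n (nmat_inv n (gram \<phi>)) (\<lambda>j. \<Sum>k\<in>UNIV. F k j * w $ k)"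

definition disc_gain ::
    "nat \<Rightarrow> (nat \<Rightarrow> 'h::real_inner) \<Rightarrow> real^'d^'d \<Rightarrow> (nat \<Rightarrow> nat \<Rightarrow> real) \<Rightarrow>
     ('d \<Rightarrow> nat \<Rightarrow> real) \<Rightarrow> real^'d \<Rightarrow> (nat \<Rightarrow> real)" where
  "disc_gain n \<phi> \<Gamma> C F =
     (\<lambda>w. nmat_app n C (fwd_adj n \<phi> F
        (inv (\<lambda>v. fwd_app n F (nmat_app n C (fwd_adj n \<phi> F v)) + \<Gamma> *v v) w)))"

definition disc_post_mean ::
    "nat \<Rightarrow> (nat \<Rightarrow> 'h::real_inner) \<Rightarrow> real^'d^'d \<Rightarrow> (nat \<Rightarrow> nat \<Rightarrow> real) \<Rightarrow>
     ('d \<Rightarrow> nat \<Rightarrow> real) \<Rightarrow> real^'d \<Rightarrow> 'h \<Rightarrow> (nat \<Rightarrow> real)" where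
  "disc_post_mean n \<phi> \<Gamma> C F y m0 =
     (\<lambda>i. coords n \<phi> m0 i + disc_gain n \<phi> \<Gamma> C F (y - fwd_app n F (coords n \<phi> m0)) i)"

text \<open>The lifted operators \<open>P\<^sup>* C P\<close> and \<open>F P\<close> on the continuum space.\<close>

definition lift_cov ::
    "nat \<Rightarrow> (nat \<Rightarrow> 'h::real_inner) \<Rightarrow> (nat \<Rightarrow> nat \<Rightarrow> real) \<Rightarrow> 'h \<Rightarrow> 'h" where
  "lift_cov n \<phi> C = (\<lambda>u. synth n \<phi> (nmat_app n C (coords n \<phi> u)))"

definition lift_fwd ::
    "nat \<Rightarrow> (nat \<Rightarrow> 'h::real_inner) \<Rightarrow> ('d \<Rightarrow> nat \<Rightarrow> real) \<Rightarrow> 'h \<Rightarrow> real^'d" where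
  "lift_fwd n \<phi> F = (\<lambda>u. fwd_app n F (coords n \<phi> u))"

section \<open>The constants of the error bound\<close>

definition const_c1 ::
    "real^'d^'d \<Rightarrow> ('h::real_inner \<Rightarrow> 'h) \<Rightarrow> ('h \<Rightarrow> real^'d) \<Rightarrow> ('h \<Rightarrow> real^'d) \<Rightarrow> real" where
  "const_c1 \<Gamma> C1 F1 F2 =
     onorm ((*v) (matrix_inv \<Gamma>)) * onorm F2
     + (onorm ((*v) (matrix_inv \<Gamma>)))\<^sup>2 * onorm C1 * onorm F1 * (onorm F2)\<^sup>2"

definition const_c2 ::
    "real^'d^'d \<Rightarrow> ('h::real_inner \<Rightarrow> 'h) \<Rightarrow> ('h \<Rightarrow> real^'d) \<Rightarrow> ('h \<Rightarrow> real^'d) \<Rightarrow> real" where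
  "const_c2 \<Gamma> C1 F1 F2 =
     onorm ((*v) (matrix_inv \<Gamma>)) * onorm C1
     + (onorm ((*v) (matrix_inv \<Gamma>)))\<^sup>2 * (onorm C1)\<^sup>2 * (onorm F1)\<^sup>2
     + (onorm ((*v) (matrix_inv \<Gamma>)))\<^sup>2 * (onorm C1)\<^sup>2 * onorm F1 * onorm F2"

end

theory Submission
  imports Defs
begin

text \<open>Write \<open>K\<^sub>i = C\<^sub>i F\<^sub>i\<^sup>* S\<^sub>i\<^sup>-\<^sup>1\<close> with \<open>S\<^sub>i = F\<^sub>i C\<^sub>i F\<^sub>i\<^sup>* + \<Gamma>\<close> for the two gains. The dual basis
  of \<open>\<phi>\<close> turns the discretized posterior mean, lifted by \<open>P\<^sup>*\<close>, into \<open>P\<^sup>* P m\<^sub>0 + K\<^sub>2 (y - F\<^sub>2 m\<^sub>0)\<close>,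
  so the error is \<open>(m\<^sub>0 - P\<^sup>* P m\<^sub>0) - K\<^sub>1 (F\<^sub>1 - F\<^sub>2) m\<^sub>0 + (K\<^sub>1 - K\<^sub>2) (y - F\<^sub>2 m\<^sub>0)\<close>. The last
  term is controlled by \<open>\<parallel>S\<^sub>i\<^sup>-\<^sup>1\<parallel> \<le> \<parallel>\<Gamma>\<^sup>-\<^sup>1\<parallel>\<close> and the telescoping identities
  \<open>K\<^sub>1 - K\<^sub>2 = C\<^sub>1 F\<^sub>1\<^sup>* S\<^sub>1\<^sup>-\<^sup>1 (S\<^sub>2 - S\<^sub>1) S\<^sub>2\<^sup>-\<^sup>1 + C\<^sub>1 (F\<^sub>1 - F\<^sub>2)\<^sup>* S\<^sub>2\<^sup>-\<^sup>1 + (C\<^sub>1 - C\<^sub>2) F\<^sub>2\<^sup>* S\<^sub>2\<^sup>-\<^sup>1\<close> and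
  \<open>S\<^sub>1 - S\<^sub>2 = F\<^sub>1 C\<^sub>1 (F\<^sub>1 - F\<^sub>2)\<^sup>* + (F\<^sub>1 - F\<^sub>2) C\<^sub>1 F\<^sub>2\<^sup>* + F\<^sub>2 (C\<^sub>1 - C\<^sub>2) F\<^sub>2\<^sup>*\<close>. The factor 2 in the
  constants absorbs \<open>\<parallel>y - F\<^sub>2 m\<^sub>0\<parallel> \<le> 2 \<parallel>y - F\<^sub>1 m\<^sub>0\<parallel>\<close>, which holds eventually when
  \<open>y \<noteq> F\<^sub>1 m\<^sub>0\<close> because \<open>F\<^sub>2 m\<^sub>0\<close> tends to \<open>F\<^sub>1 m\<^sub>0\<close>.\<close>

section \<open>Adjoints on Hilbert spaces\<close>

text \<open>The representing vector minimizes \<open>\<parallel>x\<parallel>\<^sup>2 / 2 - f x\<close>; the parallelogram law makes minimizing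
  sequences Cauchy.\<close>

lemma riesz_representation:
  fixes f :: "'a::{real_inner, complete_space} \<Rightarrow> real"
  assumes "bounded_linear f"
  shows "\<exists>z. \<forall>x. f x = x \<bullet> z"
proof -
  interpret f: bounded_linear f by fact
  define J where "J x = (norm x)\<^sup>2 / 2 - f x" for x
  define m where "m = Inf (range J)"
  have J_lower: "- (onorm f)\<^sup>2 / 2 \<le> J x" for x
  proof -
    have "f x \<le> onorm f * norm x"
      using onorm[OF assms, of x] by simp
    moreover have "0 \<le> (norm x - onorm f)\<^sup>2"
      by simp
    ultimately show ?thesis
      by (simp add: J_def power2_diff field_simps)
  qed
  have bdd: "bdd_below (range J)"
    using J_lower by (intro bdd_belowI2)
  have m_le: "m \<le> J x" for x
    unfolding m_def using bdd by (intro cInf_lower) auto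
  have "\<exists>x. J x < m + inverse (real (Suc n))" for n
    using cInf_lessD[of "range J" "m + inverse (real (Suc n))"] by (auto simp: m_def)
  then obtain X where X: "\<And>n. J (X n) < m + inverse (real (Suc n))"
    by metis
  have close: "(norm (x - y))\<^sup>2 \<le> 4 * (J x + J y - 2 * m)" for x y
  proof -
    have "J ((1/2) *\<^sub>R (x + y)) = (J x + J y) / 2 - (norm (x - y))\<^sup>2 / 8"
      by (simp add: J_def f.scaleR f.add power2_norm_eq_inner inner_commute algebra_simps
          add_divide_distrib diff_divide_distrib)
    then show ?thesis
      using m_le[of "(1/2) *\<^sub>R (x + y)"] by argo
  qed
  have "Cauchy X"
  proof (rule CauchyI)
    fix e :: real
    assume "0 < e"
    \<comment> \<open>\<open>close\<close> multiplies the sum of two excesses over \<open>m\<close>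
      by 4, so excesses below \<open>e\<^sup>2 / 8\<close> give distance below
      \<open>e\<close>.\<close>
    then obtain N where N: "inverse (real (Suc N)) < e\<^sup>2 / 8"
      using reals_Archimedean[of "e\<^sup>2 / 8"] by auto
    have small: "J (X k) - m < e\<^sup>2 / 8" if "k \<ge> N" for k
    proof -
      have "inverse (real (Suc k)) \<le> inverse (real (Suc N))"
        using that by (intro le_imp_inverse_le) auto
      then show ?thesis using X[of k] N by linarith
    qed
    have "norm (X k - X l) < e" if "k \<ge> N" "l \<ge> N" for k l
    proof (rule power2_less_imp_less)
      show "(norm (X k - X l))\<^sup>2 < e\<^sup>2"
        using close[of "X k" "X l"] small[OF that(1)] small[OF that(2)] by simp
    qed (use \<open>0 < e\<close> in simp)
    then show "\<exists>M. \<forall>k\<ge>M. \<forall>l\<ge>M. norm (X k - X l) < e"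
      by blast
  qed
  then obtain z where z: "X \<longlonglongrightarrow> z"
    using Cauchy_convergent convergent_def by blast
  have "(\<lambda>n. J (X n)) \<longlonglongrightarrow> J z"
    unfolding J_def by (intro tendsto_intros z f.tendsto) simp
  moreover have "(\<lambda>n. m + inverse (real (Suc n))) \<longlonglongrightarrow> m + 0"
    by (intro tendsto_intros LIMSEQ_inverse_real_of_nat)
  ultimately have "J z \<le> m + 0"
    using X by (intro LIMSEQ_le[where X = "\<lambda>n. J (X n)"]) (auto intro: less_imp_le)
  then have Jz: "J z \<le> J x" for x
    using m_le[of x] by simp
  have "f x = x \<bullet> z" for x
  proof (cases "x = 0")
    case True
    then show ?thesis by simp
  next
    case False
    define d where "d = x \<bullet> z - f x"
    \<comment> \<open>This \<open>t\<close> minimizes the parabola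
      \<open>s \<mapsto> J (z + s x)\<close>, whose drop below \<open>J z\<close> is
      \<open>d^2 / (2 |x|^2)\<close>; minimality of \<open>z\<close> forces
      \<open>d = 0\<close>.\<close>
    define t where "t = - d / (norm x)\<^sup>2"
    have pos: "0 < (norm x)\<^sup>2" using False by simp
    have "J (z + t *\<^sub>R x) = J z + t * d + t\<^sup>2 * (norm x)\<^sup>2 / 2"
      by (simp add: J_def d_def f.scaleR f.add power2_norm_eq_inner inner_commute
          algebra_simps power2_eq_square[of t])
    also have "\<dots> = J z - d\<^sup>2 / (2 * (norm x)\<^sup>2)"
      using pos by (simp add: t_def field_simps power2_eq_square)
    finally have "d\<^sup>2 / (2 * (norm x)\<^sup>2) \<le> 0"
      using Jz[of "z + t *\<^sub>R x"] by simp
    then have "d = 0"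
      using pos by (simp add: divide_le_0_iff)
    then show ?thesis by (simp add: d_def)
  qed
  then show ?thesis by blast
qed

text \<open>The library's \<open>adjoint\<close> is a \<open>SOME\<close>-choice, meaningful only if an adjoint exists.\<close>

definition has_adjoint :: "('a::real_inner \<Rightarrow> 'b::real_inner) \<Rightarrow> bool" where
  "has_adjoint f \<longleftrightarrow> (\<forall>x y. f x \<bullet> y = x \<bullet> adjoint f y)"

lemma has_adjointD: "has_adjoint f \<Longrightarrow> f x \<bullet> y = x \<bullet> adjoint f y"
  by (simp add: has_adjoint_def)

lemma has_adjointI: "(\<And>x y. f x \<bullet> y = x \<bullet> g y) \<Longrightarrow> has_adjoint f"
  unfolding has_adjoint_def by (metis adjoint_unique)

lemma has_adjoint_bounded_linear:
  fixes f :: "'a::{real_inner, complete_space} \<Rightarrow> 'b::real_inner"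
  assumes "bounded_linear f"
  shows "has_adjoint f"
proof -
  have "\<exists>z. \<forall>x. f x \<bullet> y = x \<bullet> z" for y
    using assms by (intro riesz_representation bounded_linear_intros)
  then obtain g where "\<And>y x. f x \<bullet> y = x \<bullet> g y" by metis
  then show ?thesis by (rule has_adjointI)
qed

lemma linear_adjoint_of_has_adjoint:
  assumes "has_adjoint f"
  shows "linear (adjoint f)"
proof (rule linearI)
  show "adjoint f (x + y) = adjoint f x + adjoint f y" for x y
    using assms by (simp add: vector_eq_ldot[symmetric] inner_add_right flip: has_adjointD)
  show "adjoint f (c *\<^sub>R x) = c *\<^sub>R adjoint f x" for c x
    using assms by (simp add: vector_eq_ldot[symmetric] flip: has_adjointD)
qed

lemma norm_le_of_inner_le:
  fixes x :: "'a::real_inner"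
  assumes "x \<bullet> x \<le> b * norm x" "0 \<le> b"
  shows "norm x \<le> b"
proof (cases "x = 0")
  case False
  then show ?thesis
    using assms(1) by (simp add: dot_square_norm power2_eq_square)
qed (use assms in simp)

text \<open>Testing with the difference of the adjoints itself moves \<open>f - g\<close> to the
  other side. The telescoping estimate needs this for a difference; \<open>g = 0\<close> yields the
  plain bound.\<close>

lemma norm_adjoint_diff_le:
  assumes "has_adjoint f" "has_adjoint g" "bounded_linear f" "bounded_linear g"
  shows "norm (adjoint f w - adjoint g w) \<le> onorm (\<lambda>x. f x - g x) * norm w"
proof (rule norm_le_of_inner_le)
  let ?x = "adjoint f w - adjoint g w"
  have bl: "bounded_linear (\<lambda>x. f x - g x)"
    using assms by (intro bounded_linear_sub)
  have "?x \<bullet> ?x = (f ?x - g ?x) \<bullet> w"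
    by (simp only: inner_diff_right inner_diff_left[of _ _ w] has_adjointD[OF assms(1)]
        has_adjointD[OF assms(2)])
  also have "\<dots> \<le> norm (f ?x - g ?x) * norm w"
    by (rule norm_cauchy_schwarz)
  also have "\<dots> \<le> onorm (\<lambda>x. f x - g x) * norm ?x * norm w"
    using onorm[OF bl, of ?x] by (intro mult_right_mono) auto
  finally show "?x \<bullet> ?x \<le> onorm (\<lambda>x. f x - g x) * norm w * norm ?x"
    by (simp add: mult_ac)
  show "0 \<le> onorm (\<lambda>x. f x - g x) * norm w"
    using onorm_pos_le[OF bl] by simp
qed

lemma norm_adjoint_le:
  assumes "has_adjoint f" "bounded_linear f"
  shows "norm (adjoint f w) \<le> onorm f * norm w"
proof -
  have "adjoint (\<lambda>x::'a. 0::'b) = (\<lambda>y. 0)"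
    by (rule adjoint_unique) simp
  moreover from this have "has_adjoint (\<lambda>x::'a. 0::'b)"
    by (simp add: has_adjoint_def)
  ultimately show ?thesis
    using norm_adjoint_diff_le[OF assms(1) _ assms(2), of "\<lambda>_. 0" w] by simp
qed

section \<open>The gain of a linear-Gaussian problem\<close>

text \<open>Positive definiteness makes the kernel trivial, so a two-sided inverse exists and the
  choice behind \<open>matrix_inv\<close> returns one.\<close>

lemma spd_matrix_inverse:
  assumes "spd_matrix \<Gamma>"
  shows "\<Gamma> *v (matrix_inv \<Gamma> *v v) = v"
proof -
  have "\<Gamma> *v x = 0 \<Longrightarrow> x = 0" for x
    using assms unfolding spd_matrix_def by (metis inner_zero_right less_irrefl)
  then have "\<exists>A. \<Gamma> ** A = mat 1 \<and> A ** \<Gamma> = mat 1"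
    by (metis matrix_left_invertible_ker matrix_left_right_inverse)
  then have "\<Gamma> ** matrix_inv \<Gamma> = mat 1"
    unfolding matrix_inv_def by (rule someI2_ex) simp
  then show ?thesis
    by (simp add: matrix_vector_mul_assoc)
qed

lemma onorm_matrix_inv_nonneg: "0 \<le> onorm ((*v) (matrix_inv (\<Gamma> :: real^'d^'d)))"
  by (intro onorm_pos_le matrix_vector_mul_bounded_linear)

text \<open>With \<open>u = \<Gamma>^-1 v\<close>, Cauchy-Schwarz for the form of
  \<open>\<Gamma>\<close> bounds \<open>|v|^4 = (u \<bullet> \<Gamma> v)^2\<close> by
  \<open>(u \<bullet> v) (v \<bullet> \<Gamma> v)\<close>, and \<open>u \<bullet> v\<close> is at
  most \<open>\<parallel>\<Gamma>^-1\<parallel> |v|^2\<close>.\<close>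

lemma spd_matrix_lower_bound:
  fixes \<Gamma> :: "real^'d^'d"
  assumes "spd_matrix \<Gamma>"
  shows "(norm v)\<^sup>2 \<le> onorm ((*v) (matrix_inv \<Gamma>)) * (v \<bullet> (\<Gamma> *v v))"
proof (cases "v = 0")
  case False
  let ?g = "onorm ((*v) (matrix_inv \<Gamma>))"
  define q where "q = v \<bullet> (\<Gamma> *v v)"
  define u where "u = matrix_inv \<Gamma> *v v"
  define N where "N = (norm v)\<^sup>2"
  have pos: "0 \<le> x \<bullet> (\<Gamma> *v x)" for x
    using assms unfolding spd_matrix_def by (cases "x = 0") (auto intro: less_imp_le)
  have sym: "x \<bullet> (\<Gamma> *v z) = z \<bullet> (\<Gamma> *v x)" for x z
    using assms unfolding spd_matrix_def
    by (metis dot_lmul_matrix inner_commute vector_transpose_matrix)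
  have q: "0 < q" using assms False by (simp add: spd_matrix_def q_def)
  have \<Gamma>u: "\<Gamma> *v u = v"
    using spd_matrix_inverse[OF assms] by (simp add: u_def)
  have "u \<bullet> v \<le> norm u * norm v"
    by (rule norm_cauchy_schwarz)
  also have "\<dots> \<le> ?g * norm v * norm v"
    unfolding u_def by (intro mult_right_mono onorm matrix_vector_mul_bounded_linear) simp
  finally have uv: "u \<bullet> v \<le> ?g * N" by (simp add: N_def power2_eq_square)
  \<comment> \<open>Cauchy--Schwarz for the form of \<open>\<Gamma>\<close>, read off the minimum of \<open>t \<mapsto> \<langle>\<Gamma>(u - t v), u - t v\<rangle>\<close>\<close>
  define t where "t = N / q"
  have "0 \<le> (u - t *\<^sub>R v) \<bullet> (\<Gamma> *v (u - t *\<^sub>R v))"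
    by (rule pos)
  also have "\<dots> = u \<bullet> v - 2 * t * N + t\<^sup>2 * q"
    using sym[of u v] dot_square_norm[of v]
    by (simp add: matrix_vector_mult_diff_distrib matrix_vector_mult_scaleR \<Gamma>u inner_diff_left
        inner_diff_right q_def N_def power2_norm_eq_inner power2_eq_square algebra_simps)
  also have "\<dots> = u \<bullet> v - N\<^sup>2 / q"
    using q by (simp add: t_def field_simps power2_eq_square)
  finally have "N * N / q \<le> ?g * N"
    using uv by (simp add: power2_eq_square)
  moreover have "0 < N" using False by (simp add: N_def)
  ultimately show ?thesis
    using q by (simp add: field_simps flip: N_def q_def)
qed simp

definition innovation_cov ::
    "real^'d^'d \<Rightarrow> ('h::real_inner \<Rightarrow> 'h) \<Rightarrow> ('h \<Rightarrow> real^'d) \<Rightarrow> real^'d \<Rightarrow> real^'d" where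
  "innovation_cov \<Gamma> C F v = F (C (adjoint F v)) + \<Gamma> *v v"

lemma gain_eq: "gain \<Gamma> C F w = C (adjoint F (inv (innovation_cov \<Gamma> C F) w))"
  by (simp add: gain_def innovation_cov_def[abs_def])

text \<open>The interface shared by the continuum problem and the lifted discretized one. The
  adjoint is a hypothesis because the two obtain it differently: by Riesz representation and by an
  explicit formula.\<close>

locale linear_gaussian =
  fixes \<Gamma> :: "real^'d^'d" and C :: "'h::real_inner \<Rightarrow> 'h" and F :: "'h \<Rightarrow> real^'d"
  assumes spd: "spd_matrix \<Gamma>"
    and bl_C: "bounded_linear C" and C_nonneg: "0 \<le> C u \<bullet> u"
    and bl_F: "bounded_linear F" and adj: "has_adjoint F"
begin

abbreviation S :: "real^'d \<Rightarrow> real^'d" where "S \<equiv> innovation_cov \<Gamma> C F"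

lemma linear_S: "linear S"
  unfolding innovation_cov_def
  by (intro linear_compose_add matrix_vector_mul_linear
      linear_compose[OF linear_adjoint_of_has_adjoint[OF adj], unfolded o_def]
      linear_compose[of "\<lambda>v. C (adjoint F v)" F, unfolded o_def]
      linear_compose[of "adjoint F" C, unfolded o_def]
      bounded_linear.linear bl_C bl_F linear_adjoint_of_has_adjoint[OF adj])

text \<open>The prior part adds a nonnegative term to the form of \<open>\<Gamma>\<close>, so the
  lower bound for \<open>\<Gamma>\<close> passes to \<open>S\<close>. This gives bijectivity of
  \<open>S\<close> and a bound on its inverse that is uniform in \<open>C\<close> and
  \<open>F\<close>.\<close>

lemma S_coercive: "norm v \<le> onorm ((*v) (matrix_inv \<Gamma>)) * norm (S v)"
proof (rule norm_le_of_inner_le)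
  let ?g = "onorm ((*v) (matrix_inv \<Gamma>))"
  have "F (C (adjoint F v)) \<bullet> v \<ge> 0"
    using C_nonneg[of "adjoint F v"] by (simp add: has_adjointD[OF adj])
  then have "v \<bullet> (\<Gamma> *v v) \<le> S v \<bullet> v"
    by (simp add: innovation_cov_def inner_add_left inner_commute[of v])
  also have "\<dots> \<le> norm (S v) * norm v"
    by (rule norm_cauchy_schwarz)
  finally have "?g * (v \<bullet> (\<Gamma> *v v)) \<le> ?g * (norm (S v) * norm v)"
    by (intro mult_left_mono onorm_matrix_inv_nonneg)
  then show "v \<bullet> v \<le> ?g * norm (S v) * norm v"
    using spd_matrix_lower_bound[OF spd, of v] by (simp add: power2_norm_eq_inner mult.assoc)
qed (simp add: onorm_matrix_inv_nonneg)

lemma bij_S: "bij S"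
proof -
  have "S v = 0 \<Longrightarrow> v = 0" for v
    using S_coercive[of v] by simp
  then have "inj S"
    using linear_S by (simp add: linear_injective_0)
  then show ?thesis
    using linear_S by (simp add: bij_def linear_injective_imp_surjective)
qed

lemma S_inv [simp]: "S (inv S w) = w"
  using bij_S by (simp add: bij_is_surj surj_f_inv_f)

lemma norm_inv_S_le: "norm (inv S w) \<le> onorm ((*v) (matrix_inv \<Gamma>)) * norm w"
  using S_coercive[of "inv S w"] by simp

text \<open>Linearity suffices, the data space being finite-dimensional.\<close>

lemma bounded_linear_gain: "bounded_linear (gain \<Gamma> C F)"
proof -
  have "linear (inv S)"
    using bij_S linear_S by (intro inj_linear_imp_inv_linear) (auto simp: bij_def)
  then have "linear (C \<circ> (adjoint F \<circ> inv S))"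
    by (intro linear_compose linear_adjoint_of_has_adjoint adj bounded_linear.linear[OF bl_C])
  then show ?thesis
    by (simp add: linear_linear gain_eq[abs_def] o_def)
qed

end

text \<open>The telescoping is ordered so that \<open>C2\<close> enters only through
  \<open>C1 - C2\<close> and \<open>inv p2.S\<close>; hence the constants contain
  \<open>onorm C1\<close> but not \<open>onorm C2\<close>.\<close>

lemma gain_perturbation:
  assumes "linear_gaussian \<Gamma> C1 F1" "linear_gaussian \<Gamma> C2 F2"
  shows "norm (gain \<Gamma> C1 F1 w - gain \<Gamma> C2 F2 w)
           \<le> (const_c1 \<Gamma> C1 F1 F2 * onorm (\<lambda>u. C1 u - C2 u)
              + const_c2 \<Gamma> C1 F1 F2 * onorm (\<lambda>u. F1 u - F2 u)) * norm w"
proof -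
  interpret p1: linear_gaussian \<Gamma> C1 F1 by fact
  interpret p2: linear_gaussian \<Gamma> C2 F2 by fact
  interpret C1: bounded_linear C1 by (rule p1.bl_C)
  interpret F1: bounded_linear F1 by (rule p1.bl_F)
  interpret F2: bounded_linear F2 by (rule p2.bl_F)
  define g where "g = onorm ((*v) (matrix_inv \<Gamma>))"
  define c where "c = onorm C1"
  define f1 where "f1 = onorm F1"
  define f2 where "f2 = onorm F2"
  define dC where "dC = onorm (\<lambda>u. C1 u - C2 u)"
  define dF where "dF = onorm (\<lambda>u. F1 u - F2 u)"
  define v1 where "v1 = inv p1.S w"
  define v2 where "v2 = inv p2.S w"
  define A1 where "A1 = adjoint F1"
  define A2 where "A2 = adjoint F2"
  have bl_dC: "bounded_linear (\<lambda>u. C1 u - C2 u)"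
    by (intro bounded_linear_sub p1.bl_C p2.bl_C)
  have bl_dF: "bounded_linear (\<lambda>u. F1 u - F2 u)"
    by (intro bounded_linear_sub p1.bl_F p2.bl_F)
  have nonneg: "0 \<le> g" "0 \<le> c" "0 \<le> f1" "0 \<le> f2" "0 \<le> dC" "0 \<le> dF"
    unfolding g_def c_def f1_def f2_def dC_def dF_def
    using p1.bl_C p1.bl_F p2.bl_F bl_dC bl_dF
    by (auto intro: onorm_pos_le onorm_matrix_inv_nonneg)
  \<comment> \<open>These bounds take the form of rules on a bound \<open>b\<close>, so that they
    chain along nested operators.\<close>
  have C1_le: "norm (C1 x) \<le> c * b" if "norm x \<le> b" for x b
    using onorm[OF p1.bl_C, of x] mult_left_mono[OF that nonneg(2)] by (simp add: c_def)
  have F1_le: "norm (F1 x) \<le> f1 * b" if "norm x \<le> b" for x b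
    using onorm[OF p1.bl_F, of x] mult_left_mono[OF that nonneg(3)] by (simp add: f1_def)
  have F2_le: "norm (F2 x) \<le> f2 * b" if "norm x \<le> b" for x b
    using onorm[OF p2.bl_F, of x] mult_left_mono[OF that nonneg(4)] by (simp add: f2_def)
  have dC_le: "norm (C1 x - C2 x) \<le> dC * b" if "norm x \<le> b" for x b
    using onorm[OF bl_dC, of x] mult_left_mono[OF that nonneg(5)] by (simp add: dC_def)
  have dF_le: "norm (F1 x - F2 x) \<le> dF * b" if "norm x \<le> b" for x b
    using onorm[OF bl_dF, of x] mult_left_mono[OF that nonneg(6)] by (simp add: dF_def)
  have A1_le: "norm (A1 x) \<le> f1 * b" if "norm x \<le> b" for x b
    using norm_adjoint_le[OF p1.adj p1.bl_F, of x] mult_left_mono[OF that nonneg(3)]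
    by (simp add: f1_def A1_def)
  have A2_le: "norm (A2 x) \<le> f2 * b" if "norm x \<le> b" for x b
    using norm_adjoint_le[OF p2.adj p2.bl_F, of x] mult_left_mono[OF that nonneg(4)]
    by (simp add: f2_def A2_def)
  have dA_le: "norm (A1 x - A2 x) \<le> dF * b" if "norm x \<le> b" for x b
    using norm_adjoint_diff_le[OF p1.adj p2.adj p1.bl_F p2.bl_F, of x]
      mult_left_mono[OF that nonneg(6)]
    by (simp add: dF_def A1_def A2_def)
  have A1_diff: "A1 x - A1 z = A1 (x - z)" for x z
    unfolding A1_def using linear_diff[OF linear_adjoint_of_has_adjoint[OF p1.adj]] by metis
  have v2: "norm v2 \<le> g * norm w"
    unfolding v2_def g_def by (rule p2.norm_inv_S_le)
  \<comment> \<open>The residual of \<open>v2\<close> in the equation solved by \<open>v1\<close>;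
    coercivity of \<open>p1.S\<close> turns it into a bound on \<open>v1 - v2\<close>.\<close>
  have "p1.S v2 - w = p1.S v2 - p2.S v2"
    by (simp add: v2_def)
  also have "\<dots> = F1 (C1 (A1 v2 - A2 v2)) + (F1 (C1 (A2 v2)) - F2 (C1 (A2 v2)))
                 + F2 (C1 (A2 v2) - C2 (A2 v2))"
    by (simp add: innovation_cov_def A1_def A2_def C1.diff F1.diff F2.diff)
  finally have "norm (p1.S v2 - w)
      \<le> f1 * (c * (dF * (g * norm w))) + dF * (c * (f2 * (g * norm w)))
        + f2 * (dC * (f2 * (g * norm w)))"
    by (auto intro!: norm_triangle_mono F1_le C1_le dA_le dF_le F2_le dC_le A2_le v2)
  moreover have "p1.S (v1 - v2) = w - p1.S v2"
    using linear_diff[OF p1.linear_S] by (simp add: v1_def)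
  ultimately have v12: "norm (v1 - v2) \<le> g * (f1 * (c * (dF * (g * norm w)))
      + dF * (c * (f2 * (g * norm w))) + f2 * (dC * (f2 * (g * norm w))))"
    using p1.S_coercive[of "v1 - v2"] nonneg(1)
    by (metis (no_types, lifting) g_def mult_left_mono norm_minus_commute order_trans)
  have "gain \<Gamma> C1 F1 w - gain \<Gamma> C2 F2 w
      = C1 (A1 (v1 - v2)) + C1 (A1 v2 - A2 v2) + (C1 (A2 v2) - C2 (A2 v2))"
    by (simp add: gain_eq A1_def[symmetric] A2_def[symmetric] v1_def[symmetric] v2_def[symmetric]
        C1.diff flip: A1_diff)
  then have "norm (gain \<Gamma> C1 F1 w - gain \<Gamma> C2 F2 w)
      \<le> c * (f1 * (g * (f1 * (c * (dF * (g * norm w)))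
          + dF * (c * (f2 * (g * norm w))) + f2 * (dC * (f2 * (g * norm w))))))
        + c * (dF * (g * norm w)) + dC * (f2 * (g * norm w))"
    by (auto intro!: norm_triangle_mono C1_le A1_le v12 dA_le dC_le A2_le v2)
  \<comment> \<open>The two summands with \<open>dC\<close> form \<open>const_c1\<close>, the three
    with \<open>dF\<close> form \<open>const_c2\<close>.\<close>
  also have "\<dots> = (const_c1 \<Gamma> C1 F1 F2 * dC + const_c2 \<Gamma> C1 F1 F2 * dF) * norm w"
    by (simp add: const_c1_def const_c2_def flip: g_def c_def f1_def f2_def)
      (simp add: algebra_simps power2_eq_square)
  finally show ?thesis
    by (simp add: dC_def dF_def)
qed


section \<open>Gram matrix and dual basis\<close>

lemma synth_inner: "synth n \<phi> a \<bullet> v = (\<Sum>i<n. a i * (\<phi> i \<bullet> v))"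
  by (simp add: synth_def inner_sum_left)

lemma synth_cong: "(\<And>i. i < n \<Longrightarrow> a i = b i) \<Longrightarrow> synth n \<phi> a = synth n \<phi> b"
  by (simp add: synth_def)

lemma synth_add: "synth n \<phi> (\<lambda>i. a i + b i) = synth n \<phi> a + synth n \<phi> b"
  by (simp add: synth_def scaleR_add_left sum.distrib)

lemma nmat_app_cong: "(\<And>i. i < n \<Longrightarrow> u i = v i) \<Longrightarrow> nmat_app n A u = nmat_app n A v"
  by (simp add: nmat_app_def)

lemma fwd_app_cong: "(\<And>i. i < n \<Longrightarrow> u i = v i) \<Longrightarrow> fwd_app n F u = fwd_app n F v"
  by (simp add: fwd_app_def)

lemma orthogonal_projection_exists:
  fixes B :: "'a::real_inner set"
  assumes "finite B"
  shows "\<exists>p\<in>span B. \<forall>v\<in>span B. (u - p) \<bullet> v = 0"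
proof -
  obtain E where E: "finite E" "span E = span B" "pairwise orthogonal E"
    using basis_orthogonal[OF assms] by blast
  \<comment> \<open>A zero vector in \<open>E\<close> is harmless: its coefficient is 0 by the
    convention for division by 0.\<close>
  define p where "p = (\<Sum>e\<in>E. (e \<bullet> u / (e \<bullet> e)) *\<^sub>R e)"
  have "p \<in> span E"
    unfolding p_def by (intro span_sum span_scale span_base)
  moreover have "(u - p) \<bullet> v = 0" if "v \<in> span E" for v
    using that
  proof (induction rule: span_induct_alt)
    case (step c e x)
    have "p \<bullet> e = (\<Sum>e'\<in>E. if e' = e then e \<bullet> u else 0)"
      unfolding p_def inner_sum_left
      using E(3) step(1) by (intro sum.cong) (auto simp: pairwise_def orthogonal_def)
    then have "p \<bullet> e = u \<bullet> e"
      using E(1) step(1) by (simp add: inner_commute)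
    then show ?case
      using step by (simp add: inner_add_right inner_diff_left)
  qed simp
  ultimately show ?thesis using E(2) by metis
qed

lemma span_image_eq_synth:
  assumes "basis_family n \<phi>" "x \<in> span (\<phi> ` {..<n})"
  shows "\<exists>a. x = synth n \<phi> a"
proof -
  obtain c where "x = (\<Sum>v\<in>\<phi> ` {..<n}. c v *\<^sub>R v)"
    using assms(2) by (auto simp: span_finite)
  then have "x = synth n \<phi> (c \<circ> \<phi>)"
    using assms(1) by (simp add: basis_family_def synth_def sum.reindex)
  then show ?thesis by blast
qed

lemma synth_in_span: "synth n \<phi> a \<in> span (\<phi> ` {..<n})"
  unfolding synth_def by (intro span_sum span_scale span_base) auto

text \<open>The residual \<open>e\<close> of \<open>\<phi> i\<close> after projection onto the span
  of the others is nonzero by independence and orthogonal to them. Since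
  \<open>e \<bullet> \<phi> i = e \<bullet> e\<close>, dividing by \<open>e \<bullet> e\<close>
  normalizes it.\<close>

lemma dual_vector_exists:
  fixes \<phi> :: "nat \<Rightarrow> 'h::real_inner"
  assumes "basis_family n \<phi>" "i < n"
  shows "\<exists>a. \<forall>j<n. synth n \<phi> a \<bullet> \<phi> j = of_bool (i = j)"
proof -
  let ?B = "\<phi> ` ({..<n} - {i})"
  obtain p where p: "p \<in> span ?B" "\<And>v. v \<in> span ?B \<Longrightarrow> (\<phi> i - p) \<bullet> v = 0"
    using orthogonal_projection_exists[of ?B "\<phi> i"] by auto
  define e where "e = \<phi> i - p"
  \<comment> \<open>By injectivity, dropping the index \<open>i\<close> drops exactly the vector
    \<open>\<phi> i\<close>.\<close>
  have "?B = \<phi> ` {..<n} - {\<phi> i}"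
    using assms by (auto simp: basis_family_def inj_on_def)
  then have "\<phi> i \<notin> span ?B"
    using assms by (auto simp: basis_family_def dependent_def)
  then have "e \<bullet> e \<noteq> 0"
    using p(1) by (auto simp: e_def)
  moreover have "e \<bullet> \<phi> i = e \<bullet> e"
    using p(2)[OF p(1)] by (simp add: e_def inner_diff_right)
  moreover have "e \<bullet> \<phi> j = 0" if "j < n" "j \<noteq> i" for j
    using that p(2)[of "\<phi> j"] by (simp add: e_def span_base)
  moreover have "p \<in> span (\<phi> ` {..<n})"
    using p(1) span_mono[of ?B "\<phi> ` {..<n}"] by auto
  then have "(1 / (e \<bullet> e)) *\<^sub>R e \<in> span (\<phi> ` {..<n})"
    using assms(2) unfolding e_def by (intro span_scale span_diff) (auto intro: span_base)
  then obtain a where "(1 / (e \<bullet> e)) *\<^sub>R e = synth n \<phi> a"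
    using span_image_eq_synth[OF assms(1)] by blast
  then have "synth n \<phi> a \<bullet> v = (e \<bullet> v) / (e \<bullet> e)" for v
    by (metis inner_scaleR_left mult_1 times_divide_eq_left)
  ultimately show ?thesis
    by (intro exI[of _ a]) auto
qed

definition dual_basis :: "nat \<Rightarrow> (nat \<Rightarrow> 'h::real_inner) \<Rightarrow> nat \<Rightarrow> 'h" where
  "dual_basis n \<phi> i = synth n \<phi> (nmat_inv n (gram \<phi>) i)"

locale discretization =
  fixes n :: nat and \<phi> :: "nat \<Rightarrow> 'h::real_inner"
  assumes basis: "basis_family n \<phi>"
begin

abbreviation B :: "nat \<Rightarrow> nat \<Rightarrow> real" where "B \<equiv> nmat_inv n (gram \<phi>)"
abbreviation \<delta> :: "nat \<Rightarrow> 'h" where "\<delta> \<equiv> dual_basis n \<phi>"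

text \<open>The coefficients of the dual vectors form a left inverse \<open>A\<close>. Its entries
  are inner products of these vectors, so it is symmetric and also a right inverse; the choice in
  \<open>nmat_inv\<close> thus has a witness.\<close>

lemma inverse_gram: "inverse_nmat n (gram \<phi>) B"
proof -
  obtain A where "\<And>i j. i < n \<Longrightarrow> j < n \<Longrightarrow> synth n \<phi> (A i) \<bullet> \<phi> j = of_bool (i = j)"
    using dual_vector_exists[OF basis] by metis
  then have A: "(\<Sum>k<n. A i k * (\<phi> k \<bullet> \<phi> j)) = of_bool (i = j)" if "i < n" "j < n" for i j
    using that by (simp add: synth_inner)
  have A_inner: "synth n \<phi> (A i) \<bullet> synth n \<phi> (A j) = A j i" if "i < n" "j < n" for i j
  proof -
    have "synth n \<phi> (A i) \<bullet> synth n \<phi> (A j) = (\<Sum>k<n. A j k * (\<phi> k \<bullet> synth n \<phi> (A i)))"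
      by (subst inner_commute) (rule synth_inner)
    also have "\<dots> = (\<Sum>k<n. if k = i then A j i else 0)"
      using that A by (intro sum.cong)
        (auto simp: synth_inner inner_commute[of "\<phi> _" "synth n \<phi> _"])
    finally show ?thesis using that by simp
  qed
  have A_sym: "A i j = A j i" if "i < n" "j < n" for i j
    using A_inner that by (metis inner_commute)
  have "(\<Sum>k<n. (\<phi> i \<bullet> \<phi> k) * A k j) = of_bool (i = j)" if "i < n" "j < n" for i j
  proof -
    have "(\<Sum>k<n. (\<phi> i \<bullet> \<phi> k) * A k j) = (\<Sum>k<n. A j k * (\<phi> k \<bullet> \<phi> i))"
      using that by (intro sum.cong) (auto simp: A_sym inner_commute)
    then show ?thesis using A that by auto
  qed
  then have "inverse_nmat n (gram \<phi>) A"
    using A by (simp add: inverse_nmat_def gram_def)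
  then show ?thesis
    unfolding nmat_inv_def by (rule someI[of "inverse_nmat n (gram \<phi>)"])
qed

lemma dual_inner: "i < n \<Longrightarrow> j < n \<Longrightarrow> \<delta> i \<bullet> \<phi> j = of_bool (i = j)"
  using inverse_gram by (simp add: dual_basis_def synth_inner inverse_nmat_def gram_def)

lemma dual_inner_synth:
  assumes "i < n"
  shows "\<delta> i \<bullet> synth n \<phi> a = a i"
proof -
  have "\<delta> i \<bullet> synth n \<phi> a = (\<Sum>j<n. a j * (\<delta> i \<bullet> \<phi> j))"
    by (simp add: synth_inner inner_commute[of "\<delta> i"])
  also have "\<dots> = (\<Sum>j<n. if j = i then a i else 0)"
    using assms by (intro sum.cong) (auto simp: dual_inner)
  finally show ?thesis using assms by simp
qed

text \<open>Both entries equal \<open>\<delta> i \<bullet> \<delta> j\<close>.\<close>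

lemma inverse_gram_sym: "i < n \<Longrightarrow> j < n \<Longrightarrow> B i j = B j i"
  using dual_inner_synth[of i "B j"] dual_inner_synth[of j "B i"]
  by (simp add: dual_basis_def inner_commute)

lemma basis_eq_sum_dual:
  assumes "i < n"
  shows "\<phi> i = (\<Sum>j<n. gram \<phi> i j *\<^sub>R \<delta> j)"
proof -
  have "(\<Sum>j<n. gram \<phi> i j *\<^sub>R \<delta> j) = (\<Sum>j<n. \<Sum>k<n. (gram \<phi> i j * B j k) *\<^sub>R \<phi> k)"
    by (simp add: dual_basis_def synth_def scaleR_sum_right)
  also have "\<dots> = (\<Sum>k<n. (\<Sum>j<n. gram \<phi> i j * B j k) *\<^sub>R \<phi> k)"
    by (subst sum.swap) (simp add: scaleR_sum_left)
  also have "\<dots> = (\<Sum>k<n. if k = i then \<phi> i else 0)"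
    using inverse_gram assms by (intro sum.cong) (auto simp: inverse_nmat_def)
  finally show ?thesis using assms by simp
qed

text \<open>Applying \<open>M^-1\<close> before lifting exchanges the basis for the dual basis; for
  \<open>h = F^T w\<close> this yields the lift of the discrete adjoint.\<close>

lemma synth_inverse_gram_app: "synth n \<phi> (nmat_app n B h) = (\<Sum>j<n. h j *\<^sub>R \<delta> j)"
proof -
  have "synth n \<phi> (nmat_app n B h) = (\<Sum>i<n. \<Sum>j<n. (h j * B j i) *\<^sub>R \<phi> i)"
    unfolding synth_def nmat_app_def scaleR_sum_left
    by (intro sum.cong) (auto simp: inverse_gram_sym mult.commute)
  also have "\<dots> = (\<Sum>j<n. h j *\<^sub>R \<delta> j)"
    by (subst sum.swap) (simp add: dual_basis_def synth_def scaleR_sum_right)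
  finally show ?thesis .
qed

text \<open>Expanding \<open>\<phi> j\<close> in the dual basis shows that the candidate and
  \<open>u\<close> have equal inner products with \<open>\<phi> j\<close>. Two projections differ by
  a vector orthogonal to itself.\<close>

lemma orth_proj_eq: "orth_proj (span (\<phi> ` {..<n})) u = synth n \<phi> (\<lambda>i. \<delta> i \<bullet> u)"
proof -
  let ?V = "span (\<phi> ` {..<n})" and ?p = "synth n \<phi> (\<lambda>i. \<delta> i \<bullet> u)"
  have p_inner: "?p \<bullet> \<phi> j = u \<bullet> \<phi> j" if "j < n" for j
  proof -
    have "?p \<bullet> \<phi> j = (\<Sum>i<n. gram \<phi> j i *\<^sub>R \<delta> i) \<bullet> u"
      by (simp add: synth_inner inner_sum_left gram_def inner_commute[of "\<phi> j"] mult.commute)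
    also have "\<dots> = u \<bullet> \<phi> j"
      using basis_eq_sum_dual[OF that] by (simp add: inner_commute)
    finally show ?thesis .
  qed
  have orth: "(u - ?p) \<bullet> v = 0" if "v \<in> ?V" for v
    using that
  proof (induction rule: span_induct_alt)
    case (step c x z)
    then show ?case
      by (auto simp: p_inner inner_add_right inner_diff_left)
  qed simp
  show ?thesis
    unfolding orth_proj_def
  proof (rule the_equality)
    show "?p \<in> ?V \<and> (\<forall>v\<in>?V. (u - ?p) \<bullet> v = 0)"
      using orth synth_in_span by blast
    fix q
    assume q: "q \<in> ?V \<and> (\<forall>v\<in>?V. (u - q) \<bullet> v = 0)"
    then have "?p - q \<in> ?V"
      by (intro span_diff synth_in_span) auto
    then have "(?p - q) \<bullet> (?p - q) = 0"
      using orth[of "?p - q"] q by (auto simp: inner_diff_left)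
    then show "q = ?p" by simp
  qed
qed

text \<open>Pairing with \<open>\<delta> i\<close> recovers coefficients below \<open>n\<close>; the
  zero padding from \<open>n\<close> on makes the whole function unique, as \<open>THE\<close>
  demands.\<close>

lemma coords_eq:
  assumes "i < n"
  shows "coords n \<phi> u i = \<delta> i \<bullet> u"
proof -
  have "coords n \<phi> u = (\<lambda>i. if i < n then \<delta> i \<bullet> u else 0)"
    unfolding coords_def orth_proj_eq
  proof (rule the_equality)
    fix c
    assume c: "(\<forall>i\<ge>n. c i = 0) \<and> synth n \<phi> c = synth n \<phi> (\<lambda>i. \<delta> i \<bullet> u)"
    show "c = (\<lambda>i. if i < n then \<delta> i \<bullet> u else 0)"
    proof
      fix i
      show "c i = (if i < n then \<delta> i \<bullet> u else 0)"
        using c dual_inner_synth[of i c] dual_inner_synth[of i "\<lambda>i. \<delta> i \<bullet> u"] by auto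
    qed
  qed (auto intro: synth_cong)
  then show ?thesis using assms by simp
qed

lemma coords_synth: "i < n \<Longrightarrow> coords n \<phi> (synth n \<phi> a) i = a i"
  by (simp add: coords_eq dual_inner_synth)

section \<open>Lifted operators and the lifted gain\<close>

lemma lift_cov_synth: "lift_cov n \<phi> C (synth n \<phi> a) = synth n \<phi> (nmat_app n C a)"
  unfolding lift_cov_def using coords_synth by (metis nmat_app_cong)

lemma lift_fwd_synth: "lift_fwd n \<phi> F (synth n \<phi> a) = fwd_app n F a"
  unfolding lift_fwd_def using coords_synth by (metis fwd_app_cong)

lemma lift_cov_eq: "lift_cov n \<phi> C u = (\<Sum>i<n. (\<Sum>j<n. C i j * (\<delta> j \<bullet> u)) *\<^sub>R \<phi> i)"
  by (simp add: lift_cov_def synth_def nmat_app_def coords_eq)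

lemma bounded_linear_lift_cov: "bounded_linear (lift_cov n \<phi> C)"
  unfolding lift_cov_eq[abs_def]
  by (intro bounded_linear_sum bounded_linear_scaleR_const bounded_linear_const_mult
      bounded_linear_inner_right)

text \<open>As \<open>\<phi> i \<bullet> u\<close> is entry \<open>i\<close> of
  \<open>M P u\<close>, the form at \<open>u\<close> is the \<open>M\<close>-form of
  \<open>C\<close> at \<open>P u\<close>. Zero coordinates, where strict positivity says nothing,
  are treated apart.\<close>

lemma lift_cov_nonneg:
  assumes "disc_covariance n \<phi> C"
  shows "0 \<le> lift_cov n \<phi> C u \<bullet> u"
proof -
  let ?c = "coords n \<phi> u"
  have "\<phi> i \<bullet> u = nmat_app n (gram \<phi>) ?c i" if "i < n" for i
  proof -
    have "\<phi> i \<bullet> u = (\<Sum>j<n. gram \<phi> i j *\<^sub>R \<delta> j) \<bullet> u"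
      using basis_eq_sum_dual[OF that] by simp
    then show ?thesis
      by (simp add: inner_sum_left nmat_app_def coords_eq)
  qed
  then have "lift_cov n \<phi> C u \<bullet> u = inner_M n \<phi> (nmat_app n C ?c) ?c"
    by (simp add: lift_cov_def synth_inner inner_M_def)
  moreover have "0 \<le> inner_M n \<phi> (nmat_app n C ?c) ?c"
  proof (cases "\<exists>i<n. ?c i \<noteq> 0")
    case True
    then show ?thesis
      using assms by (auto simp: disc_covariance_def intro: less_imp_le)
  next
    case False
    then show ?thesis by (simp add: inner_M_def nmat_app_def)
  qed
  ultimately show ?thesis by simp
qed

lemma bounded_linear_lift_fwd: "bounded_linear (lift_fwd n \<phi> F)"
proof -
  have "lift_fwd n \<phi> F = (\<lambda>u. \<Sum>j<n. (\<delta> j \<bullet> u) *\<^sub>R (vec_lambda (\<lambda>k. F k j)))"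
    by (simp add: fun_eq_iff vec_eq_iff lift_fwd_def fwd_app_def coords_eq mult.commute)
  then show ?thesis
    by (simp add: bounded_linear_sum bounded_linear_scaleR_const bounded_linear_inner_right)
qed

text \<open>Both sides expand in the numbers \<open>\<delta> j \<bullet> u\<close> with weights
  \<open>F^T w\<close>: the adjoint of \<open>F P\<close> is the lift of the discrete
  adjoint.\<close>

lemma lift_fwd_inner: "lift_fwd n \<phi> F u \<bullet> w = u \<bullet> synth n \<phi> (fwd_adj n \<phi> F w)"
proof -
  have "lift_fwd n \<phi> F u \<bullet> w = (\<Sum>k\<in>UNIV. \<Sum>j<n. F k j * (\<delta> j \<bullet> u) * w $ k)"
    by (simp add: lift_fwd_def fwd_app_def coords_eq inner_vec_def sum_distrib_right)
  also have "\<dots> = (\<Sum>j<n. \<Sum>k\<in>UNIV. F k j * (\<delta> j \<bullet> u) * w $ k)"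
    by (rule sum.swap)
  also have "\<dots> = (\<Sum>j<n. (\<Sum>k\<in>UNIV. F k j * w $ k) * (\<delta> j \<bullet> u))"
    by (simp add: sum_distrib_right mult.assoc mult.commute[of "\<delta> _ \<bullet> u"])
  also have "\<dots> = u \<bullet> synth n \<phi> (fwd_adj n \<phi> F w)"
    by (simp add: fwd_adj_def synth_inverse_gram_app inner_sum_right inner_commute)
  finally show ?thesis .
qed

lemma adjoint_lift_fwd: "adjoint (lift_fwd n \<phi> F) = (\<lambda>w. synth n \<phi> (fwd_adj n \<phi> F w))"
  by (intro adjoint_unique allI lift_fwd_inner)

lemma has_adjoint_lift_fwd: "has_adjoint (lift_fwd n \<phi> F)"
  by (rule has_adjointI) (rule lift_fwd_inner)

text \<open>Since \<open>P\<close> undoes \<open>synth\<close> on the first \<open>n\<close>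
  coordinates, the two maps on the data space under \<open>inv\<close> coincide, so no property of
  the inverse is needed.\<close>

lemma synth_disc_gain:
  "synth n \<phi> (disc_gain n \<phi> \<Gamma> C F w) = gain \<Gamma> (lift_cov n \<phi> C) (lift_fwd n \<phi> F) w"
  by (simp add: disc_gain_def gain_def adjoint_lift_fwd lift_cov_synth lift_fwd_synth)

lemma synth_disc_post_mean:
  "synth n \<phi> (disc_post_mean n \<phi> \<Gamma> C F y m0)
     = synth n \<phi> (coords n \<phi> m0)
       + gain \<Gamma> (lift_cov n \<phi> C) (lift_fwd n \<phi> F) (y - lift_fwd n \<phi> F m0)"
  by (simp add: disc_post_mean_def synth_add synth_disc_gain lift_fwd_def)

end

section \<open>Error of the posterior mean\<close>

text \<open>The estimate for a single discretization, with \<open>q0\<close> in the role of the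
  projected prior mean.\<close>

lemma post_mean_error_bound:
  fixes y :: "real^'d" and m0 q0 :: "'h::real_inner"
  assumes "linear_gaussian \<Gamma> C1 F1" "linear_gaussian \<Gamma> C2 F2"
    and "norm (m0 - q0) \<le> \<epsilon>0"
    and "onorm (\<lambda>u. C1 u - C2 u) \<le> \<epsilon>1"
    and "onorm (\<lambda>u. F1 u - F2 u) \<le> \<epsilon>2"
    and "norm (y - F2 m0) \<le> 2 * norm (y - F1 m0)"
  shows "norm (post_mean \<Gamma> C1 F1 y m0 - (q0 + gain \<Gamma> C2 F2 (y - F2 m0)))
           \<le> 2 * const_c1 \<Gamma> C1 F1 F2 * norm (y - F1 m0) * \<epsilon>1
             + (2 * const_c2 \<Gamma> C1 F1 F2 * norm (y - F1 m0)
                + norm m0 * onorm (gain \<Gamma> C1 F1)) * \<epsilon>2 + \<epsilon>0"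
proof -
  interpret p1: linear_gaussian \<Gamma> C1 F1 by fact
  interpret p2: linear_gaussian \<Gamma> C2 F2 by fact
  let ?K = "gain \<Gamma> C1 F1" and ?K2 = "gain \<Gamma> C2 F2"
  let ?c1 = "const_c1 \<Gamma> C1 F1 F2" and ?c2 = "const_c2 \<Gamma> C1 F1 F2"
  interpret K: bounded_linear ?K by (rule p1.bounded_linear_gain)
  have bl_dC: "bounded_linear (\<lambda>u. C1 u - C2 u)"
    by (intro bounded_linear_sub p1.bl_C p2.bl_C)
  have bl_dF: "bounded_linear (\<lambda>u. F1 u - F2 u)"
    by (intro bounded_linear_sub p1.bl_F p2.bl_F)
  \<comment> \<open>The signs come from the dominated operator norms, since
    \<open>r1 * \<psi>1 n\<close> and \<open>r2 * \<psi>2 n\<close> carry no sign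
    assumption.\<close>
  have pos: "0 \<le> \<epsilon>1" "0 \<le> \<epsilon>2"
    using onorm_pos_le[OF bl_dC] onorm_pos_le[OF bl_dF] assms(4,5) by linarith+
  have cpos: "0 \<le> ?c1" "0 \<le> ?c2"
    unfolding const_c1_def const_c2_def
    by (intro add_nonneg_nonneg mult_nonneg_nonneg zero_le_power onorm_matrix_inv_nonneg
        onorm_pos_le p1.bl_C p1.bl_F p2.bl_F)+
  have "post_mean \<Gamma> C1 F1 y m0 - (q0 + ?K2 (y - F2 m0))
      = (?K (y - F2 m0) - ?K2 (y - F2 m0)) - ?K (F1 m0 - F2 m0) + (m0 - q0)"
    by (simp add: post_mean_def K.diff)
  also have "norm \<dots> \<le> norm (?K (y - F2 m0) - ?K2 (y - F2 m0)) + norm (?K (F1 m0 - F2 m0))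
      + norm (m0 - q0)"
    by (intro norm_triangle_mono norm_triangle_ineq4 order_refl)
  also have "\<dots> \<le> (?c1 * \<epsilon>1 + ?c2 * \<epsilon>2) * (2 * norm (y - F1 m0))
      + onorm ?K * (\<epsilon>2 * norm m0) + \<epsilon>0"
  proof (intro add_mono assms(3))
    have "norm (?K (y - F2 m0) - ?K2 (y - F2 m0))
        \<le> (?c1 * onorm (\<lambda>u. C1 u - C2 u) + ?c2 * onorm (\<lambda>u. F1 u - F2 u)) * norm (y - F2 m0)"
      by (rule gain_perturbation[OF assms(1,2)])
    also have "\<dots> \<le> (?c1 * \<epsilon>1 + ?c2 * \<epsilon>2) * (2 * norm (y - F1 m0))"
      using pos cpos by (intro mult_mono add_mono mult_left_mono assms) auto
    finally show "norm (?K (y - F2 m0) - ?K2 (y - F2 m0)) \<le> \<dots>" .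
    have "norm (?K (F1 m0 - F2 m0)) \<le> onorm ?K * norm (F1 m0 - F2 m0)"
      by (rule onorm[OF p1.bounded_linear_gain])
    also have "\<dots> \<le> onorm ?K * (onorm (\<lambda>u. F1 u - F2 u) * norm m0)"
      by (intro mult_left_mono onorm[OF bl_dF] onorm_pos_le[OF p1.bounded_linear_gain])
    also have "\<dots> \<le> onorm ?K * (\<epsilon>2 * norm m0)"
      by (intro mult_left_mono mult_right_mono assms onorm_pos_le[OF p1.bounded_linear_gain]) auto
    finally show "norm (?K (F1 m0 - F2 m0)) \<le> onorm ?K * (\<epsilon>2 * norm m0)" .
  qed
  finally show ?thesis
    by (simp add: algebra_simps)
qed

text \<open>\<open>polish_space\<close> encodes completeness and separability, and
  \<open>norm (inv \<iota> m0)\<close> is the norm of \<open>m0\<close> in the embedded space. If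
  \<open>y = Fc m0\<close>, the terms with factor 2 vanish and the condition on \<open>n\<close>
  reads \<open>F2 n m0 = y\<close>; otherwise it holds for all large \<open>n\<close>.\<close>

theorem theorem3p3:
  fixes Fc :: "'h::{real_inner, polish_space} \<Rightarrow> real^'d"
    and Cc :: "'h \<Rightarrow> 'h"
    and \<Gamma> :: "real^'d^'d"
    and y :: "real^'d"
    and m0 :: 'h
    and \<phi> :: "nat \<Rightarrow> nat \<Rightarrow> 'h"
    and F :: "nat \<Rightarrow> 'd \<Rightarrow> nat \<Rightarrow> real"
    and C :: "nat \<Rightarrow> nat \<Rightarrow> nat \<Rightarrow> real"
    and \<iota> :: "'k::{real_inner, complete_space} \<Rightarrow> 'h"
    and r1 r2 r3 :: real
    and \<psi>1 \<psi>2 \<psi>3 :: "nat \<Rightarrow> real"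
  assumes "infinite_dimensional TYPE('h)"
    and "bounded_linear Fc"
    and "spd_matrix \<Gamma>"
    and "trace_class_covariance Cc"
    and "m0 \<in> range (sqrt_op Cc)"
    and "\<And>n. n \<ge> 1 \<Longrightarrow> basis_family n (\<phi> n)"
    and "\<And>n. n \<ge> 1 \<Longrightarrow> disc_covariance n (\<phi> n) (C n)"
    and "\<psi>1 \<longlonglongrightarrow> 0"
    and "\<And>n. n \<ge> 1 \<Longrightarrow> onorm (\<lambda>u. Cc u - lift_cov n (\<phi> n) (C n) u) \<le> r1 * \<psi>1 n"
    and "\<psi>2 \<longlonglongrightarrow> 0"
    and "\<And>n. n \<ge> 1 \<Longrightarrow> onorm (\<lambda>u. Fc u - lift_fwd n (\<phi> n) (F n) u) \<le> r2 * \<psi>2 n"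
    and "bounded_linear \<iota>" and "inj \<iota>"
    and "\<psi>3 \<longlonglongrightarrow> 0"
    and "\<And>n u. n \<ge> 1 \<Longrightarrow>
           norm (\<iota> u - synth n (\<phi> n) (coords n (\<phi> n) (\<iota> u))) \<le> r3 * \<psi>3 n * norm u"
    and "m0 \<in> range \<iota>"
  shows "let F2 = (\<lambda>n. lift_fwd n (\<phi> n) (F n));
             c1 = (\<lambda>n. const_c1 \<Gamma> Cc Fc (F2 n));
             c2 = (\<lambda>n. const_c2 \<Gamma> Cc Fc (F2 n));
             r1' = (\<lambda>n. 2 * c1 n * r1 * norm (y - Fc m0));
             r2' = (\<lambda>n. 2 * c2 n * r2 * norm (y - Fc m0)
                         + r2 * norm m0 * onorm (gain \<Gamma> Cc Fc));
             r3' = r3 * norm (inv \<iota> m0);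
             \<epsilon> = (\<lambda>n. norm (post_mean \<Gamma> Cc Fc y m0
                         - synth n (\<phi> n) (disc_post_mean n (\<phi> n) \<Gamma> (C n) (F n) y m0)))
         in (\<forall>n\<ge>1. norm (y - F2 n m0) \<le> 2 * norm (y - Fc m0) \<longrightarrow>
                \<epsilon> n \<le> r1' n * \<psi>1 n + r2' n * \<psi>2 n + r3' * \<psi>3 n)
          \<and> (y \<noteq> Fc m0 \<longrightarrow>
                (\<forall>\<^sub>F n in sequentially. \<epsilon> n \<le> r1' n * \<psi>1 n + r2' n * \<psi>2 n + r3' * \<psi>3 n))"
proof -
  have cov_pos: "positive_op Cc"
    using assms(4) by (simp add: trace_class_covariance_def)
  have lg1: "linear_gaussian \<Gamma> Cc Fc"
    using assms(2,3) cov_pos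
    by (intro linear_gaussian.intro has_adjoint_bounded_linear) (auto simp: positive_op_def)
  have disc: "discretization n (\<phi> n)" if "n \<ge> 1" for n
    using assms(6)[OF that] by (rule discretization.intro)
  have lg2: "linear_gaussian \<Gamma> (lift_cov n (\<phi> n) (C n)) (lift_fwd n (\<phi> n) (F n))"
    if "n \<ge> 1" for n
    using assms(3) assms(7)[OF that] disc[OF that]
    by (simp add: linear_gaussian_def discretization.bounded_linear_lift_cov
        discretization.bounded_linear_lift_fwd discretization.lift_cov_nonneg
        discretization.has_adjoint_lift_fwd)
  have "\<iota> (inv \<iota> m0) = m0"
    using assms(16) by (rule f_inv_into_f)
  then have err0: "norm (m0 - synth n (\<phi> n) (coords n (\<phi> n) m0)) \<le> r3 * \<psi>3 n * norm (inv \<iota> m0)"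
    if "n \<ge> 1" for n
    using assms(15)[OF that, of "inv \<iota> m0"] by simp
  let ?F2 = "\<lambda>n. lift_fwd n (\<phi> n) (F n)"
  let ?bound = "\<lambda>n. norm (post_mean \<Gamma> Cc Fc y m0
                     - synth n (\<phi> n) (disc_post_mean n (\<phi> n) \<Gamma> (C n) (F n) y m0))
      \<le> 2 * const_c1 \<Gamma> Cc Fc (?F2 n) * r1 * norm (y - Fc m0) * \<psi>1 n
        + (2 * const_c2 \<Gamma> Cc Fc (?F2 n) * r2 * norm (y - Fc m0)
           + r2 * norm m0 * onorm (gain \<Gamma> Cc Fc)) * \<psi>2 n
        + r3 * norm (inv \<iota> m0) * \<psi>3 n"
  have bound: "?bound n" if "n \<ge> 1" "norm (y - ?F2 n m0) \<le> 2 * norm (y - Fc m0)" for n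
    using post_mean_error_bound[OF lg1 lg2 err0 assms(9) assms(11)] that
    by (simp add: discretization.synth_disc_post_mean[OF disc] algebra_simps)
  have "\<forall>\<^sub>F n in sequentially. ?bound n" if "y \<noteq> Fc m0"
  proof -
    have "(\<lambda>n. r2 * \<psi>2 n * norm m0) \<longlonglongrightarrow> r2 * 0 * norm m0"
      by (intro tendsto_intros assms(10))
    \<comment> \<open>The limit 0 lies strictly below \<open>norm (y - Fc m0)\<close> because
      \<open>y \<noteq> Fc m0\<close>.\<close>
    then have "\<forall>\<^sub>F n in sequentially. r2 * \<psi>2 n * norm m0 < norm (y - Fc m0)"
      using that by (intro order_tendstoD(2)) auto
    then show ?thesis
      using eventually_ge_at_top[of 1]
    proof eventually_elim
      case (elim n)
      let ?d = "\<lambda>u. Fc u - ?F2 n u"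
      have "bounded_linear ?d"
        using lg1 lg2[OF elim(2)] by (intro bounded_linear_sub) (auto simp: linear_gaussian_def)
      then have "norm (?d m0) \<le> onorm ?d * norm m0"
        by (rule onorm)
      also have "\<dots> \<le> r2 * \<psi>2 n * norm m0"
        by (intro mult_right_mono assms(11) elim(2)) simp
      finally have "norm (y - ?F2 n m0) \<le> 2 * norm (y - Fc m0)"
        using elim(1) norm_triangle_ineq[of "y - Fc m0" "?d m0"] by simp
      then show ?case using bound elim(2) by blast
    qed
  qed
  then show ?thesis
    using bound by (simp add: Let_def)
qed

end
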